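(* Let $n\in\mathbb{N}$, let $G$ be a subgroup of $\mathrm{Sym}(n)$, and let $S$ be a non-empty subset of $[n]$. Then: (i) The (set-wise) stabilizer of $S$ in $G$ is the set of permutations $\pi\in G$ with critical element $c_S(\pi)=\infty$. (ii) $S$ is lexicographically minimal in its $G$-orbit if and only if $c_S(\pi)\notin\pi(S)$ for all $\pi\in G$. (iii) Let $S^-:=S\setminus\{\max S\}$ and assume that $S^-$ is lexicographically minimal in its $G$-orbit. Then a permutation $\pi\in G$ lex-decreases $S$ (i.e. $\pi(S)\prec S$) if and only if one of the following cases occurs: I. $c_{S^-}(\pi)=\infty$ and $\pi(\max S)<\max S$; II. $c_{S^-}(\pi)\in S^-$ and $\pi(\max S)<c_{S^-}(\pi)$; III. $c_{S^-}(\pi)\in S^-$, $\pi(\max S)=c_{S^-}(\pi)$, and $c_S(\pi)\in\pi(S)$.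
   Context: $[n]=\{1,\dots,n\}$; permutations act on subsets elementwise, $\pi(S)=\{\pi(s):s\in S\}$; the $G$-orbit of $S$ is $\{\pi(S):\pi\in G\}$. The lexicographic order on subsets is: $\emptyset\prec S$ for $S\neq\emptyset$, and for non-empty $S,R$: $S\prec R$ iff $\min S<\min R$, or $\min S=\min R$ and $S\setminus\{\min S\}\prec R\setminus\{\min R\}$. For $S\subseteq[n]$ the critical-element table with respect to $S$ is the map $c_S:G\to[n]\cup\{\infty\}$, $c_S(\pi):=\min\bigl(S\,\triangle\,\pi(S)\bigr)$, where $\triangle$ is symmetric difference and $\min\emptyset:=\infty$; $c_S(\pi)$ is the critical element of $\pi$ with respect to $S$. *)

theory Defs
  imports
    "HOL-Algebra.Sym_Groups"
    "HOL-Algebra.Group_Action"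
    "HOL-Library.Extended_Nat"
begin

text \<open>
  The lexicographic order is intended for finite sets only, since it uses \<open>Min\<close>. The two lemmas
  below state the usual recursive characterization.
\<close>

inductive lex_less :: "nat set \<Rightarrow> nat set \<Rightarrow> bool" (infix "\<prec>" 50) where
  empty: "S \<noteq> {} \<Longrightarrow> {} \<prec> S"
| Min_less: "S \<noteq> {} \<Longrightarrow> R \<noteq> {} \<Longrightarrow> Min S < Min R \<Longrightarrow> S \<prec> R"
| Min_eq: "S \<noteq> {} \<Longrightarrow> R \<noteq> {} \<Longrightarrow> Min S = Min R \<Longrightarrow> S - {Min S} \<prec> R - {Min R} \<Longrightarrow> S \<prec> R"

lemma lex_less_empty_iff: "{} \<prec> S \<longleftrightarrow> S \<noteq> {}" "\<not> S \<prec> {}"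
  by (auto elim: lex_less.cases intro: lex_less.empty)

lemma lex_less_nonempty_iff:
  assumes "S \<noteq> {}" "R \<noteq> {}"
  shows "S \<prec> R \<longleftrightarrow> Min S < Min R \<or> (Min S = Min R \<and> S - {Min S} \<prec> R - {Min R})"
  using assms by (auto elim: lex_less.cases intro: lex_less.intros)

text \<open>
  The group acts on subsets by taking images. Minimality is taken with respect to the strict
  order \<open>\<prec>\<close>: no set in the orbit is strictly smaller.
\<close>

definition lex_minimal_in_orbit :: "(nat \<Rightarrow> nat, 'b) monoid_scheme \<Rightarrow> nat set \<Rightarrow> bool" where
  "lex_minimal_in_orbit G S \<longleftrightarrow> (\<forall>R \<in> Group_Action.orbit G (`) S. \<not> R \<prec> S)"

definition critical :: "nat set \<Rightarrow> (nat \<Rightarrow> nat) \<Rightarrow> enat" where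
  "critical S \<pi> = (if sym_diff S (\<pi> ` S) = {} then \<infinity> else enat (Min (sym_diff S (\<pi> ` S))))"

end

theory Submission
  imports Defs
begin

text \<open>
  For finite sets of equal cardinality, lexicographic comparison is decided by which of the two sets
  owns the least element of their symmetric difference. Hence \<open>\<pi>(S) \<prec> S\<close> iff the critical element
  of \<open>\<pi>\<close> lies in \<open>\<pi>(S)\<close>, which gives (ii). For (iii), let \<open>c\<close> be the critical element with respect
  to \<open>S\<^sup>-\<close>. By minimality of \<open>S\<^sup>-\<close>, \<open>c\<close> is infinite or lies in \<open>S\<^sup>- - \<pi>(S\<^sup>-)\<close>, so \<open>c < max S\<close>, and
  adding \<open>max S\<close> to \<open>S\<^sup>-\<close> and \<open>\<pi>(max S)\<close> to \<open>\<pi>(S\<^sup>-)\<close> moves the critical element only if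
  \<open>\<pi>(max S) \<le> c\<close>.
\<close>

text \<open>Induction on the common cardinality, stripping equal minima. Equal cardinality excludes
  a proper initial segment \<open>A\<close> of \<open>B\<close>, for which
  \<open>A \<prec> B\<close> holds although \<open>A - B\<close> is empty.\<close>

lemma lex_less_iff_first_difference:
  assumes "finite A" "finite B" "card A = card B"
  shows "A \<prec> B \<longleftrightarrow> (\<exists>x \<in> A - B. \<forall>y<x. y \<in> A \<longleftrightarrow> y \<in> B)"
  using assms
proof (induction "card A" arbitrary: A B)
  case 0
  then show ?case by (simp add: lex_less_empty_iff)
next
  case (Suc k)
  then have ne: "A \<noteq> {}" "B \<noteq> {}" by auto
  let ?a = "Min A" and ?b = "Min B"
  have a: "?a \<in> A" "\<And>y. y < ?a \<Longrightarrow> y \<notin> A" and b: "?b \<in> B" "\<And>y. y < ?b \<Longrightarrow> y \<notin> B"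
    using Suc.prems ne by (auto dest: Min_le)
  consider "?a < ?b" | "?b < ?a" | "?a = ?b" by linarith
  then show ?case
  proof cases
    case 1
    then have "?a \<in> A - B" "\<forall>y < ?a. y \<in> A \<longleftrightarrow> y \<in> B"
      using a b by (auto dest: order.strict_trans)
    then show ?thesis using 1 ne by (auto simp: lex_less_nonempty_iff)
  next
    case 2
    \<comment> \<open>Every element of \<open>A\<close> exceeds \<open>?b\<close>, and at
      \<open>?b\<close> the two sets already disagree.\<close>
    have "\<not> (\<exists>x \<in> A - B. \<forall>y<x. y \<in> A \<longleftrightarrow> y \<in> B)"
      using a b 2 by (metis DiffD1 linorder_neqE_nat order.strict_trans)
    then show ?thesis using 2 ne by (auto simp: lex_less_nonempty_iff)
  next
    case 3
    have "A \<prec> B \<longleftrightarrow> A - {?a} \<prec> B - {?b}"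
      using 3 ne by (simp add: lex_less_nonempty_iff)
    also have "\<dots> \<longleftrightarrow>
        (\<exists>x \<in> (A - {?a}) - (B - {?b}). \<forall>y<x. y \<in> A - {?a} \<longleftrightarrow> y \<in> B - {?b})"
      using Suc.hyps(2) Suc.prems a(1) b(1) by (intro Suc.hyps(1)) auto
    \<comment> \<open>The removed minimum is common to both sets, so it is never a point of
      disagreement.\<close>
    also have "\<dots> \<longleftrightarrow> (\<exists>x \<in> A - B. \<forall>y<x. y \<in> A \<longleftrightarrow> y \<in> B)"
      using 3 a(1) b(1) by auto
    finally show ?thesis .
  qed
qed

lemma critical_eq_infinity_iff: "critical S \<pi> = \<infinity> \<longleftrightarrow> \<pi> ` S = S"
  by (auto simp: critical_def)

lemma critical_eq_enat_iff:
  assumes "finite S"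
  shows "critical S \<pi> = enat x \<longleftrightarrow>
    x \<in> sym_diff S (\<pi> ` S) \<and> (\<forall>y<x. y \<in> S \<longleftrightarrow> y \<in> \<pi> ` S)"
proof -
  have "D \<noteq> {} \<and> Min D = x \<longleftrightarrow> x \<in> D \<and> (\<forall>y<x. y \<notin> D)" if "finite D" for D :: "nat set"
    using that by (metis Min_eq_iff empty_iff not_less)
  from this[of "sym_diff S (\<pi> ` S)"] show ?thesis
    using assms by (simp add: critical_def) blast
qed

lemma image_lex_less_iff_critical:
  assumes "finite S" "inj_on \<pi> S"
  shows "\<pi> ` S \<prec> S \<longleftrightarrow> critical S \<pi> \<in> enat ` (\<pi> ` S)"
proof -
  have "\<pi> ` S \<prec> S \<longleftrightarrow> (\<exists>x \<in> \<pi> ` S - S. \<forall>y<x. y \<in> \<pi> ` S \<longleftrightarrow> y \<in> S)"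
    using assms by (intro lex_less_iff_first_difference) (auto simp: card_image)
  also have "\<dots> \<longleftrightarrow> (\<exists>x \<in> \<pi> ` S. critical S \<pi> = enat x)"
    by (auto simp: critical_eq_enat_iff[OF assms(1)])
  finally show ?thesis by auto
qed

lemma lex_minimal_in_orbit_iff:
  "lex_minimal_in_orbit (G\<lparr>carrier := H\<rparr>) S \<longleftrightarrow> (\<forall>\<pi> \<in> H. \<not> \<pi> ` S \<prec> S)"
  by (auto simp: lex_minimal_in_orbit_def orbit_def)

text \<open>Part (iii) for one fixed map: minimality of \<open>T\<close> in its orbit enters only
  through the comparison of \<pi>(T) with \<open>T\<close>.\<close>

lemma image_lex_less_iff_cases:
  fixes S :: "nat set"
  defines "m \<equiv> Max S" and "T \<equiv> S - {Max S}"
  assumes fin: "finite S" "S \<noteq> {}" and inj: "inj_on \<pi> S" and min: "\<not> \<pi> ` T \<prec> T"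
  shows "\<pi> ` S \<prec> S \<longleftrightarrow>
      (critical T \<pi> = \<infinity> \<and> \<pi> m < m)
    \<or> (critical T \<pi> \<in> enat ` T \<and> enat (\<pi> m) < critical T \<pi>)
    \<or> (critical T \<pi> \<in> enat ` T \<and> enat (\<pi> m) = critical T \<pi> \<and> critical S \<pi> \<in> enat ` (\<pi> ` S))"
    (is "_ \<longleftrightarrow> ?cases")
proof -
  have S: "S = insert m T"
    using Max_in[OF fin] by (auto simp: m_def T_def)
  have T: "finite T" "inj_on \<pi> T" "\<And>x. x \<in> T \<Longrightarrow> x < m"
    using fin inj by (auto simp: m_def T_def inj_on_diff le_neq_implies_less)
  have m: "m \<notin> T" "\<pi> m \<notin> \<pi> ` T"
    using inj S T(3) by (auto dest!: inj_onD)
  have less_iff: "\<pi> ` S \<prec> S \<longleftrightarrow> (\<exists>x \<in> \<pi> ` S - S. \<forall>y<x. y \<in> \<pi> ` S \<longleftrightarrow> y \<in> S)"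
    using fin inj by (intro lex_less_iff_first_difference) (auto simp: card_image)
  show ?thesis
  proof (cases "critical T \<pi>")
    case infinity
    then have "\<pi> ` T = T" by (simp add: critical_eq_infinity_iff)
    \<comment> \<open>Now \<pi>(S) arises from \<open>S\<close> by exchanging \<open>m\<close> for
      \<pi>(m), and neither lies in \<open>T\<close>; the smaller of the two decides.\<close>
    then have "\<pi> ` S \<prec> S \<longleftrightarrow> \<pi> m < m"
      unfolding less_iff using m
      by (auto simp: S) (metis linorder_neqE_nat)
    then show ?thesis using infinity by auto
  next
    case (enat c)
    have "critical T \<pi> \<notin> enat ` (\<pi> ` T)"
      using min T by (simp add: image_lex_less_iff_critical)
    then have c: "c \<in> T" "c \<notin> \<pi> ` T" "\<And>y. y < c \<Longrightarrow> y \<in> T \<longleftrightarrow> y \<in> \<pi> ` T"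
      using enat by (auto simp: critical_eq_enat_iff[OF T(1)])
    have cases_iff: "?cases \<longleftrightarrow> \<pi> m < c \<or> (\<pi> m = c \<and> critical S \<pi> \<in> enat ` (\<pi> ` S))"
      using enat c(1) by auto
    consider "\<pi> m < c" | "\<pi> m = c" | "c < \<pi> m" by linarith
    then show ?thesis
    proof cases
      case 1
      \<comment> \<open>Below \<open>c\<close> the sets \<open>T\<close> and \<pi>(T) agree, so
        \<pi>(m), not being in \<pi>(T), is not in \<open>T\<close> either. As \<open>c < m\<close>,
        it becomes the new first difference.\<close>
      have "\<pi> m \<in> \<pi> ` S - S"
        using 1 m c T(3)[OF c(1)] by (auto simp: S)
      moreover have "\<forall>y < \<pi> m. y \<in> \<pi> ` S \<longleftrightarrow> y \<in> S"
        using 1 c T(3)[OF c(1)] by (auto simp: S)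
      ultimately show ?thesis using 1 cases_iff less_iff by blast
    next
      case 2
      \<comment> \<open>Here \<pi>(m) fills the gap at \<open>c\<close>, so the comparison is left
        to the critical element of \<open>S\<close> itself.\<close>
      then show ?thesis using cases_iff image_lex_less_iff_critical[OF fin(1) inj] by simp
    next
      case 3
      \<comment> \<open>Both added elements \<open>m\<close> and \<pi>(m) lie above
        \<open>c\<close>, so \<open>c\<close> stays the first difference and belongs to
        \<open>S\<close>.\<close>
      have "c \<in> S - \<pi> ` S"
        using 3 c by (auto simp: S)
      moreover have "\<forall>y < c. y \<in> \<pi> ` S \<longleftrightarrow> y \<in> S"
        using 3 c T(3)[OF c(1)] by (auto simp: S)
      ultimately have "\<not> \<pi> ` S \<prec> S"
        unfolding less_iff by (metis DiffD1 DiffD2 linorder_neqE_nat)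
      then show ?thesis using 3 cases_iff by auto
    qed
  qed
qed

theorem lemma3:
  fixes n :: nat and G :: "(nat \<Rightarrow> nat) set" and S :: "nat set"
  assumes "subgroup G (sym_group n)"
    and "S \<subseteq> {1..n}" and "S \<noteq> {}"
  shows "stabilizer (sym_group n\<lparr>carrier := G\<rparr>) (`) S = {\<pi> \<in> G. critical S \<pi> = \<infinity>}
    \<and> (lex_minimal_in_orbit (sym_group n\<lparr>carrier := G\<rparr>) S
        \<longleftrightarrow> (\<forall>\<pi> \<in> G. critical S \<pi> \<notin> enat ` (\<pi> ` S)))
    \<and> (let S' = S - {Max S} in
        lex_minimal_in_orbit (sym_group n\<lparr>carrier := G\<rparr>) S' \<longrightarrow>
        (\<forall>\<pi> \<in> G. \<pi> ` S \<prec> S \<longleftrightarrow>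
            (critical S' \<pi> = \<infinity> \<and> \<pi> (Max S) < Max S)
          \<or> (critical S' \<pi> \<in> enat ` S' \<and> enat (\<pi> (Max S)) < critical S' \<pi>)
          \<or> (critical S' \<pi> \<in> enat ` S' \<and> enat (\<pi> (Max S)) = critical S' \<pi>
              \<and> critical S \<pi> \<in> enat ` (\<pi> ` S))))"
proof -
  have fin: "finite S" using assms(2) by (rule finite_subset) simp
  have inj: "inj_on \<pi> A" if "\<pi> \<in> G" for \<pi> A
    using subgroup.subset[OF assms(1)] that
    by (auto simp: sym_group_def dest: permutes_inj intro: inj_on_subset)
  have "stabilizer (sym_group n\<lparr>carrier := G\<rparr>) (`) S = {\<pi> \<in> G. critical S \<pi> = \<infinity>}"
    by (auto simp: stabilizer_def critical_eq_infinity_iff)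
  moreover have "lex_minimal_in_orbit (sym_group n\<lparr>carrier := G\<rparr>) S
      \<longleftrightarrow> (\<forall>\<pi> \<in> G. critical S \<pi> \<notin> enat ` (\<pi> ` S))"
    using image_lex_less_iff_critical[OF fin inj] by (simp add: lex_minimal_in_orbit_iff)
  ultimately show ?thesis
    using image_lex_less_iff_cases[OF fin assms(3) inj]
    unfolding Let_def lex_minimal_in_orbit_iff by blast
qed

end
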